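(* Let $p(\mathbf{x}_0)$ be a probability distribution on $\mathbb{R}^d$, and consider the choice of coupling $q(\mathbf{x}_0,\mathbf{x}_1)=p(\mathbf{x}_0)\cdot\mathcal{N}(\mathbf{x}_1\mid\mathbf{0},\mathbf{I})$. Let $$t':=\frac{t}{1+t},\qquad \bar{\mathbf{x}}_{t'}:=\frac{\mathbf{x}_t}{1+t},$$ where $t\in(0,\infty)$ and $\mathbf{x}_t$ follows the diffusion probability flow ODE $$d\mathbf{x}_t=-t\,\nabla\log p(\mathbf{x}_t)\,dt=t^{-1}\left(\mathbf{x}_t-\mathbb{E}_{p(\mathbf{x}_0\mid\mathbf{x}_t)}[\mathbf{x}_0]\right)dt .$$ Then $$\mathbb{E}_{p(\mathbf{x}_0\mid\mathbf{x}_t)}[\mathbf{x}_0]=\mathbb{E}_{q(\mathbf{x}_0\mid\bar{\mathbf{x}}_{t'})}[\mathbf{x}_0],$$ and $\bar{\mathbf{x}}_{t'}$ follows the ODE $$d\bar{\mathbf{x}}_{t'}={t'}^{-1}\left(\bar{\mathbf{x}}_{t'}-\mathbb{E}_{q(\mathbf{x}_0\mid\bar{\mathbf{x}}_{t'})}[\mathbf{x}_0]\right)dt'$$ on $t'\in(0,1)$. Furthermore, let $G_{\mathrm{CTM}},g_{\mathrm{CTM}}$ denote the CTM solutions and $G_{\mathrm{GCTM}},g_{\mathrm{GCTM}}$ the GCTM solutions (defined in the context). Then, for $0<s\le t<\infty$ and with $s'=s/(1+s)$, $$G_{\mathrm{CTM}}(\mathbf{x}_t,t,s)=G_{\mathrm{GCTM}}(\bar{\mathbf{x}}_{t'},t',s')\cdot(1+s),\qquad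 g_{\mathrm{CTM}}(\mathbf{x}_t,t,t)=g_{\mathrm{GCTM}}(\bar{\mathbf{x}}_{t'},t',t').$$
   Context: Diffusion side. The forward SDE is $d\mathbf{x}_t=\sqrt{2t}\,d\mathbf{w}_t$ with $\mathbf{x}_0\sim p(\mathbf{x}_0)$ and $\mathbf{w}_t$ a standard Wiener process on $\mathbb{R}^d$; thus, given $\mathbf{x}_0$, $\mathbf{x}_t$ has law $p(\mathbf{x}_t\mid\mathbf{x}_0)=\mathcal{N}(\mathbf{x}_0,t^2\mathbf{I})$ for $t>0$. Here $p(\mathbf{x}_t)$ denotes the marginal density of $\mathbf{x}_t$, and $p(\mathbf{x}_0\mid\mathbf{x}_t)$ the conditional law of $\mathbf{x}_0$ given $\mathbf{x}_t$ (given by Bayes' rule, for every value of $\mathbf{x}_t\in\mathbb{R}^d$). Flow matching side. For the joint distribution $q(\mathbf{x}_0,\mathbf{x}_1)=p(\mathbf{x}_0)\cdot\mathcal{N}(\mathbf{x}_1\mid\mathbf{0},\mathbf{I})$ and $r\in(0,1)$, let $q(\mathbf{x}_r)$ be the law of $(1-r)\mathbf{x}_0+r\mathbf{x}_1$ with $(\mathbf{x}_0,\mathbf{x}_1)\sim q(\mathbf{x}_0,\mathbf{x}_1)$, and let $q(\mathbf{x}_0\mid\mathbf{x}_r)$ be the conditional law of $\mathbf{x}_0$ given that $(1-r)\mathbf{x}_0+r\mathbf{x}_1=\mathbf{x}_r$ (given by Bayes' rule, for every value of $\mathbf{x}_r\in\mathbb{R}^d$). In the claim, $q(\mathbf{x}_0\mid\bar{\mathbf{x}}_{t'})$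 is this conditional law at time $r=t'$, evaluated at the point $\bar{\mathbf{x}}_{t'}$. The associated ODE on $r\in(0,1)$ is $d\mathbf{x}_r=r^{-1}(\mathbf{x}_r-\mathbb{E}_{q(\mathbf{x}_0\mid\mathbf{x}_r)}[\mathbf{x}_0])\,dr$. CTM solutions: for $0<s\le t<\infty$, $G_{\mathrm{CTM}}(\mathbf{x}_t,t,s):=\mathbf{x}_t+\int_t^s u^{-1}(\mathbf{x}_u-\mathbb{E}_{p(\mathbf{x}_0\mid\mathbf{x}_u)}[\mathbf{x}_0])\,du$, where $u\mapsto\mathbf{x}_u$ is the solution of the probability flow ODE passing through $\mathbf{x}_t$ at time $t$ (so $G_{\mathrm{CTM}}(\mathbf{x}_t,t,s)=\mathbf{x}_s$). The function $g_{\mathrm{CTM}}$ is defined for $s<t$ by $G_{\mathrm{CTM}}(\mathbf{x}_t,t,s)=\frac{s}{t}\mathbf{x}_t+(1-\frac{s}{t})g_{\mathrm{CTM}}(\mathbf{x}_t,t,s)$, and for $s=t$ by $g_{\mathrm{CTM}}(\mathbf{x}_t,t,t):=\mathbb{E}_{p(\mathbf{x}_0\mid\mathbf{x}_t)}[\mathbf{x}_0]$. GCTM solutions: for $0<s\le t<1$, $G_{\mathrm{GCTM}}(\mathbf{x}_t,t,s):=\mathbf{x}_t+\int_t^s u^{-1}(\mathbf{x}_u-\mathbb{E}_{q(\mathbf{x}_0\mid\mathbf{x}_u)}[\mathbf{x}_0])\,du$, where $u\mapsto\mathbf{x}_u$ is the solution of the flow matching side ODE passing through $\mathbf{x}_t$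 at time $t$. The function $g_{\mathrm{GCTM}}$ is defined for $s<t$ by $G_{\mathrm{GCTM}}(\mathbf{x}_t,t,s)=\frac{s}{t}\mathbf{x}_t+(1-\frac{s}{t})g_{\mathrm{GCTM}}(\mathbf{x}_t,t,s)$, and for $s=t$ by $g_{\mathrm{GCTM}}(\mathbf{x}_t,t,t):=\mathbb{E}_{q(\mathbf{x}_0\mid\mathbf{x}_t)}[\mathbf{x}_0]$. Convention: solutions of the ODEs through given points are assumed to exist and be unique on the relevant time intervals. *)

theory Defs
  imports "HOL-Probability.Probability"
begin

section \<open>Isotropic Gaussians and Bayes' rule\<close>

text \<open>Lebesgue density at \<open>x\<close> of the normal distribution with mean \<open>\<mu>\<close> and covariance \<open>\<sigma>\<^sup>2 I\<close>.\<close>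

definition gauss_density :: "'a::euclidean_space \<Rightarrow> real \<Rightarrow> 'a \<Rightarrow> real" where
  "gauss_density \<mu> \<sigma> x =
     exp (- (norm (x - \<mu>))\<^sup>2 / (2 * \<sigma>\<^sup>2)) / sqrt (2 * pi * \<sigma>\<^sup>2) ^ DIM('a)"

definition gauss_measure :: "'a::euclidean_space \<Rightarrow> real \<Rightarrow> 'a measure" where
  "gauss_measure \<mu> \<sigma> = density lborel (\<lambda>x. ennreal (gauss_density \<mu> \<sigma> x))"

text \<open>For a prior \<open>p\<close> and a likelihood \<open>k\<close>, where \<open>k z x\<close> is the conditional density at \<open>x\<close> given
  the latent value \<open>z\<close>: the marginal density at \<open>x\<close>, and the conditional law of the latent value
  given the observation \<open>x\<close>. Bayes' rule defines the latter for every \<open>x\<close>, not only up to null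
  sets.\<close>

definition marginal_density :: "'a measure \<Rightarrow> ('a \<Rightarrow> 'b \<Rightarrow> real) \<Rightarrow> 'b \<Rightarrow> real" where
  "marginal_density p k x = (\<integral>z. k z x \<partial>p)"

definition bayes_posterior :: "'a measure \<Rightarrow> ('a \<Rightarrow> 'b \<Rightarrow> real) \<Rightarrow> 'b \<Rightarrow> 'a measure" where
  "bayes_posterior p k x = density p (\<lambda>z. ennreal (k z x / marginal_density p k x))"


section \<open>Ordinary differential equations\<close>

definition solves_ode_on :: "(real \<Rightarrow> 'a \<Rightarrow> 'a::real_normed_vector) \<Rightarrow> real set \<Rightarrow> (real \<Rightarrow> 'a) \<Rightarrow> bool" where
  "solves_ode_on F I y \<longleftrightarrow> (\<forall>u\<in>I. (y has_vector_derivative F u (y u)) (at u))"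

text \<open>Membership in \<^const>\<open>extensional\<close> fixes the values outside the interval, so that uniqueness on
  the (open) interval \<open>I\<close> is uniqueness of the HOL function.\<close>

definition ode_solution_through ::
    "(real \<Rightarrow> 'a \<Rightarrow> 'a::real_normed_vector) \<Rightarrow> real set \<Rightarrow> real \<Rightarrow> 'a \<Rightarrow> (real \<Rightarrow> 'a) \<Rightarrow> bool" where
  "ode_solution_through F I t z y \<longleftrightarrow> y \<in> extensional I \<and> y t = z \<and> solves_ode_on F I y"

definition well_posed_at ::
    "(real \<Rightarrow> 'a \<Rightarrow> 'a::real_normed_vector) \<Rightarrow> real set \<Rightarrow> real \<Rightarrow> 'a \<Rightarrow> bool" where
  "well_posed_at F I t z \<longleftrightarrow> (\<exists>!y. ode_solution_through F I t z y)"

definition the_ode_solution ::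
    "(real \<Rightarrow> 'a \<Rightarrow> 'a::real_normed_vector) \<Rightarrow> real set \<Rightarrow> real \<Rightarrow> 'a \<Rightarrow> real \<Rightarrow> 'a" where
  "the_ode_solution F I t z = (THE y. ode_solution_through F I t z y)"


section \<open>Diffusion\<close>

text \<open>Given the data point \<open>z\<close>, the forward process at time \<open>t\<close> has law \<open>N(z, t\<^sup>2 I)\<close>.\<close>

definition diffusion_kernel :: "real \<Rightarrow> 'a \<Rightarrow> 'a::euclidean_space \<Rightarrow> real" where
  "diffusion_kernel t z = gauss_density z t"

definition diffusion_density :: "'a::euclidean_space measure \<Rightarrow> real \<Rightarrow> 'a \<Rightarrow> real" where
  "diffusion_density p t = marginal_density p (diffusion_kernel t)"

definition diffusion_posterior :: "'a::euclidean_space measure \<Rightarrow> real \<Rightarrow> 'a \<Rightarrow> 'a measure" where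
  "diffusion_posterior p t = bayes_posterior p (diffusion_kernel t)"

definition diffusion_mean :: "'a::euclidean_space measure \<Rightarrow> real \<Rightarrow> 'a \<Rightarrow> 'a" where
  "diffusion_mean p t x = (\<integral>z. z \<partial>diffusion_posterior p t x)"

definition score :: "'a::euclidean_space measure \<Rightarrow> real \<Rightarrow> 'a \<Rightarrow> 'a" where
  "score p t x = (THE g. GDERIV (\<lambda>y. ln (diffusion_density p t y)) x :> g)"

definition probability_flow_field :: "'a::euclidean_space measure \<Rightarrow> real \<Rightarrow> 'a \<Rightarrow> 'a" where
  "probability_flow_field p t x = - (t *\<^sub>R score p t x)"

definition G_CTM :: "'a::euclidean_space measure \<Rightarrow> 'a \<Rightarrow> real \<Rightarrow> real \<Rightarrow> 'a" where
  "G_CTM p x t s =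
     (let y = the_ode_solution (probability_flow_field p) {0<..} t x
      in x + (LBINT u=ereal t..ereal s. (1 / u) *\<^sub>R (y u - diffusion_mean p u (y u))))"

text \<open>The first branch is the solution \<open>g\<close> of
  \<open>G_CTM p x t s = (s / t) *\<^sub>R x + (1 - s / t) *\<^sub>R g\<close>.\<close>

definition g_CTM :: "'a::euclidean_space measure \<Rightarrow> 'a \<Rightarrow> real \<Rightarrow> real \<Rightarrow> 'a" where
  "g_CTM p x t s =
     (if s < t then (1 / (1 - s / t)) *\<^sub>R (G_CTM p x t s - (s / t) *\<^sub>R x)
      else diffusion_mean p t x)"


section \<open>Flow matching\<close>

definition coupling :: "'a::euclidean_space measure \<Rightarrow> ('a \<times> 'a) measure" where
  "coupling p = p \<Otimes>\<^sub>M gauss_measure 0 1"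

definition flow_law :: "'a::euclidean_space measure \<Rightarrow> real \<Rightarrow> 'a measure" where
  "flow_law p r = distr (coupling p) borel (\<lambda>(x0, x1). (1 - r) *\<^sub>R x0 + r *\<^sub>R x1)"

text \<open>Under the coupling, given \<open>x0 = z\<close>, the interpolant \<open>(1 - r) x0 + r x1\<close> has law
  \<open>N((1 - r) z, r\<^sup>2 I)\<close>. Lemma \<open>flow_posterior_disintegration\<close> below shows that the posterior
  defined from this kernel is a conditional law of \<open>x0\<close> under the coupling.\<close>

definition flow_kernel :: "real \<Rightarrow> 'a \<Rightarrow> 'a::euclidean_space \<Rightarrow> real" where
  "flow_kernel r z = gauss_density ((1 - r) *\<^sub>R z) r"

definition flow_posterior :: "'a::euclidean_space measure \<Rightarrow> real \<Rightarrow> 'a \<Rightarrow> 'a measure" where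
  "flow_posterior p r = bayes_posterior p (flow_kernel r)"

definition flow_mean :: "'a::euclidean_space measure \<Rightarrow> real \<Rightarrow> 'a \<Rightarrow> 'a" where
  "flow_mean p r x = (\<integral>z. z \<partial>flow_posterior p r x)"

definition flow_matching_field :: "'a::euclidean_space measure \<Rightarrow> real \<Rightarrow> 'a \<Rightarrow> 'a" where
  "flow_matching_field p r x = (1 / r) *\<^sub>R (x - flow_mean p r x)"

definition G_GCTM :: "'a::euclidean_space measure \<Rightarrow> 'a \<Rightarrow> real \<Rightarrow> real \<Rightarrow> 'a" where
  "G_GCTM p x t s =
     (let y = the_ode_solution (flow_matching_field p) {0<..<1} t x
      in x + (LBINT u=ereal t..ereal s. (1 / u) *\<^sub>R (y u - flow_mean p u (y u))))"

definition g_GCTM :: "'a::euclidean_space measure \<Rightarrow> 'a \<Rightarrow> real \<Rightarrow> real \<Rightarrow> 'a" where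
  "g_GCTM p x t s =
     (if s < t then (1 / (1 - s / t)) *\<^sub>R (G_GCTM p x t s - (s / t) *\<^sub>R x)
      else flow_mean p t x)"


section \<open>The posteriors are conditional laws with finite mean\<close>

lemma gauss_density_pos: "\<sigma> \<noteq> 0 \<Longrightarrow> 0 < gauss_density \<mu> \<sigma> x"
  by (simp add: gauss_density_def)

lemma gauss_density_nonneg: "0 \<le> gauss_density \<mu> \<sigma> x"
  by (simp add: gauss_density_def)

lemma measurable_gauss_density [measurable]:
  fixes f g :: "'b \<Rightarrow> 'a::euclidean_space"
  assumes [measurable]: "f \<in> borel_measurable M" "g \<in> borel_measurable M"
  shows "(\<lambda>w. gauss_density (f w) \<sigma> (g w)) \<in> borel_measurable M"
  unfolding gauss_density_def by measurable

lemma gauss_density_prod: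
  fixes x :: "'a::euclidean_space"
  shows "gauss_density 0 1 x = (\<Prod>b\<in>Basis. std_normal_density (x \<bullet> b))"
proof -
  have "(norm x)\<^sup>2 = (\<Sum>b\<in>Basis. (x \<bullet> b)\<^sup>2)"
    using euclidean_inner[of x x] by (simp add: power2_norm_eq_inner) (simp add: power2_eq_square)
  then have "exp (- (norm x)\<^sup>2 / 2) = (\<Prod>b\<in>Basis. exp (- (x \<bullet> b)\<^sup>2 / 2))"
    by (simp add: exp_sum[symmetric] sum_negf sum_divide_distrib)
  then show ?thesis
    by (simp add: gauss_density_def normal_density_def prod_dividef power_one_over)
qed

lemma nn_integral_gauss_std:
  "(\<integral>\<^sup>+x. ennreal (gauss_density (0::'a::euclidean_space) 1 x) \<partial>lborel) = 1"
proof -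
  interpret N: prob_space "density lborel std_normal_density"
    by (rule prob_space_normal_density) simp
  have 1: "(\<integral>\<^sup>+x. ennreal (std_normal_density x) \<partial>lborel) = 1"
    using N.emeasure_space_1 by (simp add: emeasure_density)
  have "(\<integral>\<^sup>+x. ennreal (gauss_density (0::'a) 1 x) \<partial>lborel)
      = (\<integral>\<^sup>+x. (\<Prod>b\<in>(Basis :: 'a set). ennreal (std_normal_density (x \<bullet> b))) \<partial>lborel)"
    by (simp add: gauss_density_prod prod_ennreal)
  also have "\<dots> = (\<Prod>b\<in>(Basis :: 'a set). (\<integral>\<^sup>+x. ennreal (std_normal_density x) \<partial>lborel))"
    by (rule nn_integral_lborel_prod) auto
  finally show ?thesis by (simp add: 1)
qed

lemma prob_space_gauss_std: "prob_space (gauss_measure (0::'a::euclidean_space) 1)"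
  by (rule prob_spaceI) (simp add: gauss_measure_def emeasure_density nn_integral_gauss_std)

lemma gauss_density_affine:
  fixes \<mu> z :: "'a::euclidean_space"
  assumes "0 < \<sigma>"
  shows "\<sigma> ^ DIM('a) * gauss_density \<mu> \<sigma> (\<mu> + \<sigma> *\<^sub>R z) = gauss_density 0 1 z"
proof -
  have "sqrt (2 * pi * \<sigma>\<^sup>2) = \<sigma> * sqrt (2 * pi)"
    using assms by (simp add: real_sqrt_mult)
  then show ?thesis
    using assms by (simp add: gauss_density_def power_mult_distrib)
qed

lemma nn_integral_gauss_affine:
  fixes \<mu> :: "'a::euclidean_space"
  assumes "0 < \<sigma>" and [measurable]: "f \<in> borel_measurable borel"
  shows "(\<integral>\<^sup>+x. ennreal (gauss_density \<mu> \<sigma> x) * f x \<partial>lborel)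
       = (\<integral>\<^sup>+z. ennreal (gauss_density 0 1 z) * f (\<mu> + \<sigma> *\<^sub>R z) \<partial>lborel)"
proof -
  have "(\<integral>\<^sup>+x. ennreal (gauss_density \<mu> \<sigma> x) * f x \<partial>lborel)
      = (\<integral>\<^sup>+x. ennreal (gauss_density \<mu> \<sigma> x) * f x
           \<partial>density (distr lborel borel (\<lambda>z. \<mu> + \<sigma> *\<^sub>R z)) (\<lambda>_. \<bar>\<sigma>\<bar> ^ DIM('a)))"
    using lborel_affine[of \<sigma> \<mu>] assms(1) by simp
  also have "\<dots> = (\<integral>\<^sup>+z. ennreal (\<sigma> ^ DIM('a)) *
      (ennreal (gauss_density \<mu> \<sigma> (\<mu> + \<sigma> *\<^sub>R z)) * f (\<mu> + \<sigma> *\<^sub>R z)) \<partial>lborel)"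
    using assms(1) by (simp add: nn_integral_density nn_integral_distr)
  also have "\<dots> = (\<integral>\<^sup>+z. ennreal (gauss_density 0 1 z) * f (\<mu> + \<sigma> *\<^sub>R z) \<partial>lborel)"
    using assms(1)
    by (simp add: gauss_density_affine[OF assms(1), of \<mu>, symmetric] ennreal_mult
        gauss_density_nonneg mult.assoc)
  finally show ?thesis .
qed

lemma gauss_density_le:
  "gauss_density \<mu> \<sigma> (x::'a::euclidean_space) \<le> 1 / sqrt (2 * pi * \<sigma>\<^sup>2) ^ DIM('a)"
  unfolding gauss_density_def by (rule divide_right_mono) auto

lemma norm_gauss_density_le:
  fixes x z :: "'a::euclidean_space"
  assumes "0 < a" "0 < \<sigma>"
  shows "norm z * gauss_density (a *\<^sub>R z) \<sigma> x
       \<le> (norm x + \<sigma>) / a / sqrt (2 * pi * \<sigma>\<^sup>2) ^ DIM('a)"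
proof -
  define v where "v = norm (x - a *\<^sub>R z) / \<sigma>"
  have v: "0 \<le> v" "norm (x - a *\<^sub>R z) = \<sigma> * v"
    using assms by (auto simp: v_def)
  have "v \<le> 1 + v\<^sup>2 / 2"
    using zero_le_power2[of "v - 1"] by (simp add: power2_diff)
  also have "\<dots> \<le> exp (v\<^sup>2 / 2)" by (rule exp_ge_add_one_self)
  finally have ve: "v * exp (- (v\<^sup>2) / 2) \<le> 1"
    by (simp add: exp_minus field_simps)
  have e: "exp (- (norm (x - a *\<^sub>R z))\<^sup>2 / (2 * \<sigma>\<^sup>2)) = exp (- (v\<^sup>2) / 2)"
    using assms by (simp add: v(2) power_mult_distrib)
  have "a * norm z = norm (x - (x - a *\<^sub>R z))" using assms by simp
  also have "\<dots> \<le> norm x + \<sigma> * v" using norm_triangle_ineq4[of x "x - a *\<^sub>R z"] v(2) by simp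
  finally have "a * norm z * exp (- (v\<^sup>2) / 2) \<le> (norm x + \<sigma> * v) * exp (- (v\<^sup>2) / 2)"
    by (rule mult_right_mono) simp
  also have "\<dots> = norm x * exp (- (v\<^sup>2) / 2) + \<sigma> * (v * exp (- (v\<^sup>2) / 2))"
    by (simp add: algebra_simps)
  also have "\<dots> \<le> norm x * 1 + \<sigma> * 1"
    using assms ve by (intro add_mono mult_left_mono) auto
  finally have "norm z * exp (- (v\<^sup>2) / 2) \<le> (norm x + \<sigma>) / a"
    using assms by (simp add: field_simps)
  then show ?thesis
    unfolding gauss_density_def e times_divide_eq_right by (rule divide_right_mono) simp
qed

context
  fixes p :: "'a::euclidean_space measure" and a \<sigma> :: real and k :: "'a \<Rightarrow> 'a \<Rightarrow> real"
  assumes prob: "prob_space p" and sets_p [measurable_cong]: "sets p = sets borel"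
    and pos: "0 < a" "0 < \<sigma>"
    and k: "k = (\<lambda>z. gauss_density (a *\<^sub>R z) \<sigma>)"
begin

interpretation prob_space p by (rule prob)

lemma kernel_nonneg: "0 \<le> k z x"
  by (simp add: k gauss_density_nonneg)

lemma kernel_integrable: "integrable p (\<lambda>z. k z x)"
  unfolding k
  by (rule integrable_const_bound[where B = "1 / sqrt (2 * pi * \<sigma>\<^sup>2) ^ DIM('a)"])
    (simp_all add: gauss_density_le gauss_density_nonneg)

lemma marginal_pos: "0 < marginal_density p k x"
proof -
  have "0 \<le> marginal_density p k x"
    unfolding marginal_density_def by (intro integral_nonneg_AE) (simp add: k gauss_density_nonneg)
  moreover have "marginal_density p k x \<noteq> 0"
  proof
    assume "marginal_density p k x = 0"
    then have "AE z in p. k z x = 0"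
      unfolding marginal_density_def
      by (subst (asm) integral_nonneg_eq_0_iff_AE[OF kernel_integrable])
        (auto simp: k gauss_density_nonneg)
    moreover have "k z x \<noteq> 0" for z
      using gauss_density_pos[of \<sigma> "a *\<^sub>R z" x] pos by (simp add: k)
    ultimately have "AE z in p. False" by simp
    then show False by simp
  qed
  ultimately show ?thesis by simp
qed

lemma ennreal_marginal: "ennreal (marginal_density p k x) = (\<integral>\<^sup>+z. ennreal (k z x) \<partial>p)"
  unfolding marginal_density_def
  by (rule nn_integral_eq_integral[OF kernel_integrable, symmetric])
    (auto simp: k gauss_density_nonneg)

lemma kernel_measurable [measurable]: "(\<lambda>z. k z x) \<in> borel_measurable p"
  by (simp add: k)

lemma marginal_measurable [measurable]: "marginal_density p k \<in> borel_measurable borel"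
  unfolding marginal_density_def[abs_def] k by measurable

lemma prob_space_posterior: "prob_space (bayes_posterior p k x)"
proof (rule prob_spaceI)
  have "emeasure (bayes_posterior p k x) (space (bayes_posterior p k x))
      = (\<integral>\<^sup>+z. ennreal (k z x / marginal_density p k x) \<partial>p)"
    unfolding bayes_posterior_def by (subst emeasure_density) (auto intro!: nn_integral_cong)
  also have "\<dots> = (\<integral>\<^sup>+z. ennreal (k z x) \<partial>p) / ennreal (marginal_density p k x)"
    using marginal_pos[of x]
    by (subst nn_integral_divide[symmetric]) (simp_all add: divide_ennreal kernel_nonneg)
  also have "\<dots> = 1"
    using marginal_pos[of x] by (simp flip: ennreal_marginal add: divide_ennreal)
  finally show "emeasure (bayes_posterior p k x) (space (bayes_posterior p k x)) = 1" .
qed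

lemma integrable_posterior: "integrable (bayes_posterior p k x) (\<lambda>z. z)"
proof -
  let ?c = "(norm x + \<sigma>) / a / sqrt (2 * pi * \<sigma>\<^sup>2) ^ DIM('a)"
  have "integrable p (\<lambda>z. (k z x / marginal_density p k x) *\<^sub>R z)"
  proof (rule integrable_const_bound[where B = "?c / marginal_density p k x"])
    have "norm ((k z x / marginal_density p k x) *\<^sub>R z) \<le> ?c / marginal_density p k x" for z
    proof -
      have "norm ((k z x / marginal_density p k x) *\<^sub>R z) = norm z * k z x / marginal_density p k x"
        using marginal_pos[of x] kernel_nonneg[of z x] by (simp add: mult.commute)
      also have "\<dots> \<le> ?c / marginal_density p k x"
        using norm_gauss_density_le[OF pos, of z x] marginal_pos[of x]
        by (intro divide_right_mono) (simp_all add: k less_imp_le)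
      finally show ?thesis .
    qed
    then show "AE z in p. norm ((k z x / marginal_density p k x) *\<^sub>R z) \<le> ?c / marginal_density p k x"
      by simp
  qed measurable
  then show ?thesis
    unfolding bayes_posterior_def using marginal_pos[of x]
    by (subst integrable_density) (auto simp: k gauss_density_nonneg less_imp_le)
qed

lemma joint_emeasure:
  assumes [measurable]: "A \<in> sets borel" "B \<in> sets borel"
  shows "emeasure (coupling p) {w \<in> space (coupling p). fst w \<in> A \<and> a *\<^sub>R fst w + \<sigma> *\<^sub>R snd w \<in> B}
       = (\<integral>\<^sup>+x. emeasure (bayes_posterior p k x) A * indicator B x
            \<partial>density lborel (\<lambda>x. ennreal (marginal_density p k x)))"
proof -
  interpret N: prob_space "gauss_measure (0::'a) 1" by (rule prob_space_gauss_std)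
  interpret P: pair_sigma_finite p "gauss_measure (0::'a) 1" ..
  interpret L: pair_sigma_finite p "lborel :: 'a measure" ..
  have sp: "space p = UNIV" using sets_eq_imp_space_eq[OF sets_p] by simp
  have sN [measurable_cong]: "sets (gauss_measure (0::'a) 1) = sets borel"
    by (simp add: gauss_measure_def)
  let ?S = "{w \<in> space (coupling p). fst w \<in> A \<and> a *\<^sub>R fst w + \<sigma> *\<^sub>R snd w \<in> B}"
  have spc: "space (coupling p) = UNIV"
    by (simp add: coupling_def space_pair_measure sp gauss_measure_def)
  have S: "?S \<in> sets (p \<Otimes>\<^sub>M gauss_measure 0 1)"
    unfolding coupling_def by measurable
  have "emeasure (coupling p) ?S = (\<integral>\<^sup>+w. indicator ?S w \<partial>(p \<Otimes>\<^sub>M gauss_measure 0 1))"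
    using S by (simp add: coupling_def)
  also have "\<dots> = (\<integral>\<^sup>+z. \<integral>\<^sup>+y. indicator ?S (z, y) \<partial>gauss_measure 0 1 \<partial>p)"
    using S by (subst N.nn_integral_fst[symmetric]) auto
  also have "\<dots> = (\<integral>\<^sup>+z. \<integral>\<^sup>+y. ennreal (gauss_density 0 1 y) *
      (indicator A z * indicator B (a *\<^sub>R z + \<sigma> *\<^sub>R y)) \<partial>lborel \<partial>p)"
  proof (rule nn_integral_cong)
    fix z
    have *: "indicator ?S (z, y) = (indicator A z * indicator B (a *\<^sub>R z + \<sigma> *\<^sub>R y) :: ennreal)" for y
      using spc by (auto simp: indicator_def)
    show "(\<integral>\<^sup>+y. indicator ?S (z, y) \<partial>gauss_measure 0 1) =
      (\<integral>\<^sup>+y. ennreal (gauss_density 0 1 y) *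
      (indicator A z * indicator B (a *\<^sub>R z + \<sigma> *\<^sub>R y)) \<partial>lborel)"
      unfolding * gauss_measure_def by (subst nn_integral_density) auto
  qed
  also have "\<dots> = (\<integral>\<^sup>+z. \<integral>\<^sup>+x. ennreal (k z x) * (indicator A z * indicator B x) \<partial>lborel \<partial>p)"
    unfolding k using pos
    by (intro nn_integral_cong nn_integral_gauss_affine[symmetric]) auto
  also have "\<dots> = (\<integral>\<^sup>+x. \<integral>\<^sup>+z. ennreal (k z x) * (indicator A z * indicator B x) \<partial>p \<partial>lborel)"
    unfolding k by (rule L.Fubini'[symmetric]) measurable
  also have "\<dots> = (\<integral>\<^sup>+x. ennreal (marginal_density p k x) *
      (emeasure (bayes_posterior p k x) A * indicator B x) \<partial>lborel)"
  proof (rule nn_integral_cong)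
    fix x :: 'a
    let ?m = "marginal_density p k x"
    have "ennreal ?m * emeasure (bayes_posterior p k x) A
        = (\<integral>\<^sup>+z. ennreal ?m * (ennreal (k z x / ?m) * indicator A z) \<partial>p)"
      unfolding bayes_posterior_def
      by (subst nn_integral_cmult) (auto simp: emeasure_density sets_p)
    also have "\<dots> = (\<integral>\<^sup>+z. ennreal (k z x) * indicator A z \<partial>p)"
      using marginal_pos[of x]
      by (intro nn_integral_cong)
        (simp add: kernel_nonneg mult.assoc[symmetric] ennreal_mult'[symmetric])
    finally have "ennreal ?m * (emeasure (bayes_posterior p k x) A * indicator B x)
        = (\<integral>\<^sup>+z. ennreal (k z x) * indicator A z \<partial>p) * indicator B x"
      by (simp add: mult.assoc[symmetric])
    also have "\<dots> = (\<integral>\<^sup>+z. (ennreal (k z x) * indicator A z) * indicator B x \<partial>p)"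
      by (subst nn_integral_multc) (auto simp: sets_p)
    finally show "(\<integral>\<^sup>+z. ennreal (k z x) * (indicator A z * indicator B x) \<partial>p)
        = ennreal ?m * (emeasure (bayes_posterior p k x) A * indicator B x)"
      by (simp add: mult.assoc)
  qed
  also have "\<dots> = (\<integral>\<^sup>+x. emeasure (bayes_posterior p k x) A * indicator B x
      \<partial>density lborel (\<lambda>x. ennreal (marginal_density p k x)))"
  proof (subst nn_integral_density)
    have "(\<lambda>x. \<integral>\<^sup>+z. ennreal (k z x / marginal_density p k x) * indicator A z \<partial>p)
        \<in> borel_measurable borel"
      unfolding k using marginal_measurable[unfolded k] by measurable
    then have "(\<lambda>x. emeasure (bayes_posterior p k x) A) \<in> borel_measurable borel"
      unfolding bayes_posterior_def by (subst emeasure_density) (auto simp: sets_p)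
    then show "(\<lambda>x. emeasure (bayes_posterior p k x) A * indicator B x) \<in> borel_measurable lborel"
      by measurable
  qed auto
  finally show ?thesis .
qed

end

lemma diffusion_kernel_gauss: "diffusion_kernel t = (\<lambda>z. gauss_density (1 *\<^sub>R z) t)"
  by (simp add: diffusion_kernel_def fun_eq_iff)

lemma flow_kernel_gauss: "flow_kernel r = (\<lambda>z. gauss_density ((1 - r) *\<^sub>R z) r)"
  by (simp add: flow_kernel_def fun_eq_iff)

text \<open>With an independent standard normal \<open>x1\<close>, the variable \<open>x0 + t x1\<close> has the same joint law with
  \<open>x0\<close> as the forward process at time \<open>t\<close>.\<close>

lemma diffusion_posterior_disintegration:
  fixes p :: "'a::euclidean_space measure"
  assumes "prob_space p" "sets p = sets borel" "0 < t" "A \<in> sets borel" "B \<in> sets borel"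
  shows "emeasure (coupling p) {w \<in> space (coupling p). fst w \<in> A \<and> fst w + t *\<^sub>R snd w \<in> B}
       = (\<integral>\<^sup>+x. emeasure (diffusion_posterior p t x) A * indicator B x
            \<partial>density lborel (\<lambda>x. ennreal (diffusion_density p t x)))"
  unfolding diffusion_posterior_def diffusion_density_def
  using joint_emeasure[OF assms(1,2) _ assms(3) diffusion_kernel_gauss assms(4,5)] by simp

lemma flow_posterior_disintegration:
  fixes p :: "'a::euclidean_space measure"
  assumes p: "prob_space p" "sets p = sets borel" and r: "0 < r" "r < 1"
    and A: "A \<in> sets borel" and B: "B \<in> sets borel"
  shows "emeasure (coupling p)
           {w \<in> space (coupling p). fst w \<in> A \<and> (1 - r) *\<^sub>R fst w + r *\<^sub>R snd w \<in> B}
       = (\<integral>\<^sup>+x. emeasure (flow_posterior p r x) A * indicator B x \<partial>flow_law p r)"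
proof -
  have r': "0 < 1 - r" using r by simp
  note J = joint_emeasure[OF p r' r(1) flow_kernel_gauss]
  have sN [measurable_cong]: "sets (gauss_measure (0::'a) 1) = sets borel"
    by (simp add: gauss_measure_def)
  note p(2) [measurable_cong]
  have "flow_law p r = density lborel (\<lambda>x. ennreal (marginal_density p (flow_kernel r) x))"
  proof (rule measure_eqI)
    fix C assume "C \<in> sets (flow_law p r)"
    then have C [measurable]: "C \<in> sets borel" by (simp add: flow_law_def)
    have "emeasure (flow_law p r) C
        = emeasure (coupling p)
           {w \<in> space (coupling p). fst w \<in> UNIV \<and> (1 - r) *\<^sub>R fst w + r *\<^sub>R snd w \<in> C}"
      unfolding flow_law_def coupling_def
      by (subst emeasure_distr) (auto intro!: arg_cong2[where f=emeasure])
    also have "\<dots> = (\<integral>\<^sup>+x. indicator C x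
        \<partial>density lborel (\<lambda>x. ennreal (marginal_density p (flow_kernel r) x)))"
      using prob_space.emeasure_space_1[OF prob_space_posterior[OF p r' r(1) flow_kernel_gauss]]
        sets_eq_imp_space_eq[OF p(2)]
      by (subst J) (auto simp: bayes_posterior_def)
    finally show "emeasure (flow_law p r) C
        = emeasure (density lborel (\<lambda>x. ennreal (marginal_density p (flow_kernel r) x))) C"
      by simp
  qed (simp add: flow_law_def)
  then show ?thesis
    unfolding flow_posterior_def using J[OF A B] by simp
qed

lemma integrable_diffusion_posterior:
  assumes "prob_space p" "sets p = sets borel" "0 < t"
  shows "integrable (diffusion_posterior p t x) (\<lambda>z. z)"
  unfolding diffusion_posterior_def
  by (rule integrable_posterior[OF assms(1,2) zero_less_one assms(3) diffusion_kernel_gauss])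

lemma integrable_flow_posterior:
  assumes "prob_space p" "sets p = sets borel" "0 < r" "r < 1"
  shows "integrable (flow_posterior p r x) (\<lambda>z. z)"
  unfolding flow_posterior_def
  using integrable_posterior[OF assms(1,2) _ assms(3) flow_kernel_gauss] assms(4) by simp

end

theory Submission
  imports Defs
begin

text \<open>Rescaling space by \<open>1 / (1 + t)\<close> turns the kernel \<open>N(z, t\<^sup>2 I)\<close> into \<open>N((1 - t') z, t'\<^sup>2 I)\<close>, up
  to a factor independent of \<open>z\<close>, which cancels in Bayes' rule. So the two posteriors are the same
  measure, and the chain rule carries one ODE into the other. By the fundamental theorem of calculus
  the integrals \<open>G\<close> are values of the trajectories; this needs continuity of the posterior mean
  along a trajectory. The score formula (Tweedie) is differentiation under the integral sign.\<close>

section \<open>Taylor bound for the Gaussian, and gradient calculus\<close>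

text \<open>On the segment from \<open>x\<close> to \<open>x + h\<close> the exponent is a quadratic
  polynomial in one real variable, so Taylor's formula on the line suffices. The bound is free of
  \<open>\<mu>\<close> and \<open>x\<close> because the exponential absorbs the growth of the
  polynomial factor in the second derivative.\<close>

lemma gauss_density_taylor:
  fixes \<mu> x h :: "'a::euclidean_space"
  assumes \<sigma>: "0 < \<sigma>"
  shows "\<bar>gauss_density \<mu> \<sigma> (x + h) - gauss_density \<mu> \<sigma> x
            - gauss_density \<mu> \<sigma> x / \<sigma>\<^sup>2 * ((\<mu> - x) \<bullet> h)\<bar>
         \<le> 3 / (2 * \<sigma>\<^sup>2) / sqrt (2 * pi * \<sigma>\<^sup>2) ^ DIM('a) * (norm h)\<^sup>2"
proof -
  define v where "v = \<sigma>\<^sup>2"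
  have v: "0 < v" using \<sigma> by (simp add: v_def)
  define b where "b = (x - \<mu>) \<bullet> h"
  define c where "c = h \<bullet> h"
  define N where "N s = (norm (x + s *\<^sub>R h - \<mu>))\<^sup>2" for s
  have N: "N s = (norm (x - \<mu>))\<^sup>2 + 2 * s * b + s\<^sup>2 * c" for s
  proof -
    define a where "a = x - \<mu>"
    have "x + s *\<^sub>R h - \<mu> = a + s *\<^sub>R h" by (simp add: a_def)
    then show ?thesis
      unfolding N_def b_def c_def a_def[symmetric]
      by (simp add: power2_norm_eq_inner inner_add_left inner_add_right)
        (simp add: power2_eq_square algebra_simps inner_commute)
  qed
  define f where "f s = exp (- N s / (2 * v))" for s
  define f' where "f' s = - (b + s * c) / v * f s" for s
  define f'' where "f'' s = ((b + s * c)\<^sup>2 / v\<^sup>2 - c / v) * f s" for s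
  have df: "(f has_real_derivative f' s) (at s)" for s
    unfolding f_def f'_def N using v
    by (auto intro!: derivative_eq_intros simp: field_simps)
  have df': "(f' has_real_derivative f'' s) (at s)" for s
  proof -
    have "((\<lambda>s. - (b + s * c) / v) has_real_derivative - c / v) (at s)"
      using v by (auto intro!: derivative_eq_intros)
    from DERIV_mult[OF this df[of s]] have "(f' has_real_derivative
        - c / v * f s + f' s * (- (b + s * c) / v)) (at s)"
      by (simp add: f'_def[abs_def])
    also have "- c / v * f s + f' s * (- (b + s * c) / v) = f'' s"
      unfolding f'_def f''_def using v by (simp add: field_simps power2_eq_square)
    finally show ?thesis .
  qed
  \<comment> \<open>The list serves as the family of derivatives, read only at indices 0 to 2. The
    location of \<open>s\<close> is then dropped, as the bound on \<open>f''\<close> below holds at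
    every real point.\<close>
  have "\<exists>s. 0 < s \<and> s \<le> 1 \<and> f 1 = (\<Sum>m<2. (\<lambda>m. [f, f', f''] ! m) m 0 / fact m * 1 ^ m)
      + (\<lambda>m. [f, f', f''] ! m) 2 s / fact 2 * 1 ^ 2"
    by (rule Maclaurin2) (auto simp: less_2_cases_iff df df')
  then obtain s where s: "f 1 = f 0 + f' 0 + f'' s / 2"
    by (auto simp: numeral_2_eq_2)
  \<comment> \<open>The 3 is 2 + 1: Cauchy-Schwarz and \<open>y * exp (- y)\<close> \<le> 1 bound
    the square term by \<open>2 * c / v\<close>, and \<open>exp (- y)\<close> \<le> 1 bounds the
    other term by \<open>c / v\<close>.\<close>
  have "\<bar>f'' s\<bar> \<le> 3 / v * c"
  proof -
    define y where "y = N s / (2 * v)"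
    have y: "0 \<le> y" "f s = exp (- y)" using v by (auto simp: y_def f_def N_def)
    have "y \<le> exp y" using exp_ge_add_one_self[of y] by linarith
    then have ye: "y * exp (- y) \<le> 1" by (simp add: exp_minus field_simps)
    have "b + s * c = (x + s *\<^sub>R h - \<mu>) \<bullet> h"
      by (simp add: b_def c_def inner_diff_left inner_add_left)
    then have "(b + s * c)\<^sup>2 \<le> N s * c"
      unfolding N_def c_def
      using Cauchy_Schwarz_ineq[of "x + s *\<^sub>R h - \<mu>" h] by (simp add: power2_norm_eq_inner)
    then have "(b + s * c)\<^sup>2 / v\<^sup>2 \<le> N s * c / v\<^sup>2" by (rule divide_right_mono) simp
    also have "\<dots> = 2 * y * c / v" using v by (simp add: y_def power2_eq_square)
    finally have "(b + s * c)\<^sup>2 / v\<^sup>2 * exp (- y) \<le> 2 * y * c / v * exp (- y)"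
      by (rule mult_right_mono) simp
    also have "\<dots> = 2 * c / v * (y * exp (- y))" by simp
    also have "\<dots> \<le> 2 * c / v * 1" using v ye by (intro mult_left_mono) (auto simp: c_def)
    finally have 1: "(b + s * c)\<^sup>2 / v\<^sup>2 * exp (- y) \<le> 2 * c / v" by simp
    have 2: "c / v * exp (- y) \<le> c / v * 1"
      using v y by (intro mult_left_mono) (auto simp: c_def)
    have 3: "0 \<le> (b + s * c)\<^sup>2 / v\<^sup>2 * exp (- y)" "0 \<le> c / v * exp (- y)"
      using v by (auto simp: c_def)
    have "f'' s = (b + s * c)\<^sup>2 / v\<^sup>2 * exp (- y) - c / v * exp (- y)"
      by (simp add: f''_def y left_diff_distrib)
    moreover have "3 / v * c = 2 * c / v + c / v" by (simp add: add_divide_distrib[symmetric])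
    ultimately show ?thesis using 1 2 3 by linarith
  qed
  then have *: "\<bar>f 1 - f 0 - f' 0\<bar> \<le> 3 / (2 * v) * (norm h)\<^sup>2"
    unfolding s by (simp add: c_def power2_norm_eq_inner)
  define K where "K = sqrt (2 * pi * \<sigma>\<^sup>2) ^ DIM('a)"
  have K: "0 < K" using \<sigma> by (simp add: K_def)
  have gd: "gauss_density \<mu> \<sigma> (x + h) = f 1 / K" "gauss_density \<mu> \<sigma> x = f 0 / K"
    by (simp_all add: gauss_density_def f_def N_def v_def K_def)
  have hb: "(\<mu> - x) \<bullet> h = - b" by (simp add: b_def inner_diff_left)
  have "gauss_density \<mu> \<sigma> (x + h) - gauss_density \<mu> \<sigma> x
            - gauss_density \<mu> \<sigma> x / \<sigma>\<^sup>2 * ((\<mu> - x) \<bullet> h) = (f 1 - f 0 - f' 0) / K"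
    unfolding gd hb f'_def v_def[symmetric] using K v by (simp add: field_simps)
  then show ?thesis
    using divide_right_mono[OF *, of K] K by (simp add: v_def K_def)
qed

lemma ln_gderiv:
  assumes "GDERIV f x :> g" "0 < f x"
  shows "GDERIV (\<lambda>y. ln (f y)) x :> (1 / f x) *\<^sub>R g"
  using GDERIV_DERIV_compose[OF assms(1) DERIV_ln_divide[OF assms(2)]] .

text \<open>Evaluating both derivative maps at \<open>g - g'\<close> forces that vector to have norm
  zero. This makes the description operator in \<open>score\<close> computable.\<close>

lemma gderiv_unique:
  assumes "GDERIV f x :> g" "GDERIV f x :> g'"
  shows "g = g'"
proof -
  have "(\<lambda>h. h \<bullet> g) = (\<lambda>h. h \<bullet> g')"
    using assms unfolding gderiv_def by (rule has_derivative_unique)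
  then have "(g - g') \<bullet> g = (g - g') \<bullet> g'" by metis
  then have "(g - g') \<bullet> (g - g') = 0" by (simp add: inner_diff_right)
  then show ?thesis by simp
qed

section \<open>Kernels and posterior means under rescaling\<close>

text \<open>Since \<open>1 - t / (1 + t) = 1 / (1 + t)\<close>, the point, the mean and the standard
  deviation all shrink by the same factor. The exponent is therefore unchanged, and only the
  normalising constant picks up one factor \<open>1 + t\<close> per dimension.\<close>

lemma flow_kernel_rescale:
  fixes z x :: "'a::euclidean_space"
  assumes "0 < t"
  shows "flow_kernel (t / (1 + t)) z ((1 / (1 + t)) *\<^sub>R x)
       = (1 + t) ^ DIM('a) * diffusion_kernel t z x"
proof -
  have r: "1 - t / (1 + t) = 1 / (1 + t)" using assms by (simp add: field_simps)
  have "2 * pi * (t / (1 + t))\<^sup>2 = 2 * pi * t\<^sup>2 / (1 + t)\<^sup>2"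
    by (simp add: power_divide)
  then have "sqrt (2 * pi * (t / (1 + t))\<^sup>2) = sqrt (2 * pi * t\<^sup>2) / (1 + t)"
    using assms by (simp add: real_sqrt_divide)
  moreover have "(norm ((1 / (1 + t)) *\<^sub>R x - (1 / (1 + t)) *\<^sub>R z))\<^sup>2 / (2 * (t / (1 + t))\<^sup>2)
      = (norm (x - z))\<^sup>2 / (2 * t\<^sup>2)"
    using assms by (simp flip: scaleR_right_diff_distrib add: power_divide)
  ultimately show ?thesis
    unfolding flow_kernel_def diffusion_kernel_def gauss_density_def r
    using assms by (simp add: power_divide)
qed

lemma flow_mean_rescale:
  fixes p :: "'a::euclidean_space measure"
  assumes t: "0 < t"
  shows "flow_mean p (t / (1 + t)) ((1 / (1 + t)) *\<^sub>R x) = diffusion_mean p t x"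
proof -
  have "flow_posterior p (t / (1 + t)) ((1 / (1 + t)) *\<^sub>R x) = diffusion_posterior p t x"
    unfolding flow_posterior_def diffusion_posterior_def bayes_posterior_def marginal_density_def
      flow_kernel_rescale[OF t]
    using t by simp
  then show ?thesis by (simp add: flow_mean_def diffusion_mean_def)
qed

section \<open>Score formula for the diffusion marginal\<close>

context
  fixes p :: "'a::euclidean_space measure"
  assumes prob: "prob_space p" and sets_p [measurable_cong]: "sets p = sets borel"
begin

interpretation prob_space p by (rule prob)

lemma gauss_density_integrable: "integrable p (\<lambda>w. gauss_density w t (z::'a))"
  by (rule integrable_const_bound[where B = "1 / sqrt (2 * pi * t\<^sup>2) ^ DIM('a)"])
    (simp_all add: gauss_density_le gauss_density_nonneg)

text \<open>The Gaussian absorbs the linear growth in \<open>w\<close>, which gives a constant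
  majorant. It yields integrability over the probability measure \<open>p\<close> and later
  dominated convergence.\<close>

lemma norm_scaleR_gauss_density_le:
  fixes w z :: 'a
  assumes "0 < t"
  shows "norm (gauss_density w t z *\<^sub>R w) \<le> (norm z + t) / sqrt (2 * pi * t\<^sup>2) ^ DIM('a)"
  using norm_gauss_density_le[of 1 t w z] assms by (simp add: gauss_density_nonneg mult.commute)

lemma gauss_density_scaleR_integrable:
  assumes t: "0 < t"
  shows "integrable p (\<lambda>w. gauss_density w t z *\<^sub>R w)"
  by (rule integrable_const_bound[OF AE_I2[OF norm_scaleR_gauss_density_le[OF t]]]) measurable

lemma diffusion_density_pos: "0 < t \<Longrightarrow> 0 < diffusion_density p t z"
  unfolding diffusion_density_def
  using marginal_pos[OF prob sets_p zero_less_one _ diffusion_kernel_gauss] .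

lemma diffusion_density_integral: "diffusion_density p t z = (\<integral>w. gauss_density w t z \<partial>p)"
  by (simp add: diffusion_density_def marginal_density_def diffusion_kernel_def)

text \<open>A quotient of two integrals over the fixed measure \<open>p\<close>, so that
  \<open>t\<close> and \<open>z\<close> enter only through the integrands and limits can be taken
  separately in numerator and denominator.\<close>

lemma diffusion_mean_integral:
  assumes t: "0 < t"
  shows "diffusion_mean p t z
       = (1 / diffusion_density p t z) *\<^sub>R (\<integral>w. gauss_density w t z *\<^sub>R w \<partial>p)"
proof -
  have "diffusion_mean p t z = (\<integral>w. (gauss_density w t z / diffusion_density p t z) *\<^sub>R w \<partial>p)"
    unfolding diffusion_mean_def diffusion_posterior_def bayes_posterior_def
      diffusion_density_def[symmetric] diffusion_kernel_def
    using diffusion_density_pos[OF t, of z]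
    by (subst integral_density) (auto simp: gauss_density_nonneg less_imp_le)
  also have "\<dots> = (\<integral>w. (1 / diffusion_density p t z) *\<^sub>R (gauss_density w t z *\<^sub>R w) \<partial>p)"
    by simp
  finally show ?thesis by (simp only: integral_scaleR_right)
qed

text \<open>The remainder in \<open>gauss_density_taylor\<close> is uniform in the latent point, so it
  integrates to a quadratic remainder for the marginal.\<close>

lemma gderiv_diffusion_density:
  assumes t: "0 < t"
  shows "GDERIV (diffusion_density p t) z :>
    (diffusion_density p t z / t\<^sup>2) *\<^sub>R (diffusion_mean p t z - z)"
proof -
  define C where "C = 3 / (2 * t\<^sup>2) / sqrt (2 * pi * t\<^sup>2) ^ DIM('a)"
  \<comment> \<open>The gradient in \<open>z\<close> of \<open>gauss_density w t z\<close>, split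
    into two vectors that are each integrable in \<open>w\<close>.\<close>
  define D where "D w = (1 / t\<^sup>2) *\<^sub>R (gauss_density w t z *\<^sub>R w - gauss_density w t z *\<^sub>R z)" for w
  let ?g = "(diffusion_density p t z / t\<^sup>2) *\<^sub>R (diffusion_mean p t z - z)"
  have intz: "integrable p (\<lambda>w. gauss_density w t z *\<^sub>R z)"
    using gauss_density_integrable by (intro integrable_scaleR_left) auto
  have intD: "integrable p D"
    unfolding D_def
    by (intro integrable_scaleR_right Bochner_Integration.integrable_diff intz
        gauss_density_scaleR_integrable t)
  have "(\<integral>w. D w \<partial>p) = (1 / t\<^sup>2) *\<^sub>R
      ((\<integral>w. gauss_density w t z *\<^sub>R w \<partial>p) - (\<integral>w. gauss_density w t z *\<^sub>R z \<partial>p))"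
    unfolding D_def integral_scaleR_right
    by (subst Bochner_Integration.integral_diff[OF gauss_density_scaleR_integrable[OF t] intz]) simp
  also have "(\<integral>w. gauss_density w t z *\<^sub>R z \<partial>p) = diffusion_density p t z *\<^sub>R z"
    unfolding diffusion_density_integral
    by (rule integral_scaleR_left) (rule gauss_density_integrable)
  also have "(\<integral>w. gauss_density w t z *\<^sub>R w \<partial>p)
      = diffusion_density p t z *\<^sub>R diffusion_mean p t z"
    using diffusion_density_pos[OF t, of z] by (simp add: diffusion_mean_integral[OF t])
  finally have D: "(\<integral>w. D w \<partial>p) = ?g"
    by (simp add: scaleR_right_diff_distrib)
  have rem: "\<bar>diffusion_density p t (z + h) - diffusion_density p t z - h \<bullet> ?g\<bar> \<le> C * (norm h)\<^sup>2"
    for h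
  proof -
    let ?R = "\<lambda>w. gauss_density w t (z + h) - gauss_density w t z - h \<bullet> D w"
    have int: "integrable p ?R"
      by (intro Bochner_Integration.integrable_diff gauss_density_integrable
          integrable_inner_right intD)
    have bound: "\<bar>?R w\<bar> \<le> C * (norm h)\<^sup>2" for w
    proof -
      have "h \<bullet> D w = gauss_density w t z / t\<^sup>2 * ((w - z) \<bullet> h)"
        by (simp add: D_def inner_commute[of h] flip: scaleR_right_diff_distrib)
      then show ?thesis
        using gauss_density_taylor[OF t, of w z h] by (simp add: C_def)
    qed
    \<comment> \<open>Unfolding the density also rewrites the copy inside \<open>?g\<close>, so
      \<open>D\<close> has to be unfolded in the same way before it can replace
      \<open>?g\<close>.\<close>
    have "diffusion_density p t (z + h) - diffusion_density p t z - h \<bullet> ?g = (\<integral>w. ?R w \<partial>p)"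
      unfolding diffusion_density_integral D[symmetric, unfolded diffusion_density_integral]
      by (simp add: gauss_density_integrable intD)
    also have "norm (\<integral>w. ?R w \<partial>p) \<le> (\<integral>w. C * (norm h)\<^sup>2 \<partial>p)"
      by (rule Bochner_Integration.integral_norm_bound_integral) (use int bound in auto)
    finally show ?thesis by simp (simp add: prob_space)
  qed
  show ?thesis
    unfolding gderiv_def
  proof (rule has_derivativeI_sandwich[of 1 _ UNIV, simplified])
    show "bounded_linear (\<lambda>h. h \<bullet> ?g)" by (rule bounded_linear_inner_left)
    show "((\<lambda>y. C * norm (y - z)) \<longlongrightarrow> 0) (at z)"
      by (auto intro!: tendsto_eq_intros)
    fix y assume "y \<noteq> z"
    then show "norm (diffusion_density p t y - diffusion_density p t z - (y - z) \<bullet> ?g) / norm (y - z)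
        \<le> C * norm (y - z)"
      using rem[of "y - z"] by (simp add: divide_le_eq power2_eq_square mult.assoc)
  qed
qed

text \<open>The density factor of the gradient cancels against the derivative of the logarithm,
  which leaves Tweedie's formula.\<close>

lemma gderiv_ln_diffusion_density:
  assumes t: "0 < t"
  shows "GDERIV (\<lambda>y. ln (diffusion_density p t y)) z :> (1 / t\<^sup>2) *\<^sub>R (diffusion_mean p t z - z)"
  using ln_gderiv[OF gderiv_diffusion_density[OF t, of z] diffusion_density_pos[OF t]]
    diffusion_density_pos[OF t, of z] by simp

lemma score_eq:
  assumes t: "0 < t"
  shows "score p t z = (1 / t\<^sup>2) *\<^sub>R (diffusion_mean p t z - z)"
  unfolding score_def
  using gderiv_ln_diffusion_density[OF t, of z] by (blast intro: the_equality gderiv_unique)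

lemma probability_flow_field_eq:
  assumes t: "0 < t"
  shows "probability_flow_field p t z = (1 / t) *\<^sub>R (z - diffusion_mean p t z)"
proof -
  have "t * (1 / t\<^sup>2) = 1 / t" by (simp add: power2_eq_square)
  then show ?thesis
    by (simp add: probability_flow_field_def score_eq[OF t] algebra_simps)
qed

section \<open>Continuity of the posterior mean along a curve\<close>

text \<open>Dominated convergence applies to numerator and denominator along a sequence of times.
  Constant majorants exist because \<open>a > 0\<close> keeps the normalising constants away from
  zero and the curve is bounded on a compact interval.\<close>

lemma continuous_on_diffusion_mean:
  assumes y: "continuous_on {a..b} y" and a: "0 < a"
  shows "continuous_on {a..b} (\<lambda>u. diffusion_mean p u (y u))"
proof (rule continuous_on_sequentiallyI)
  fix u l assume u: "\<forall>n::nat. u n \<in> {a..b}" and l: "l \<in> {a..b}" and lim: "u \<longlonglongrightarrow> l"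
  have ylim: "(\<lambda>n. y (u n)) \<longlonglongrightarrow> y l"
    using y u l lim by (auto simp: continuous_on_sequentially o_def)
  have pos: "0 < u n" "0 < l" for n using u l a by (auto simp: less_le_trans)
  have "bounded (y ` {a..b})"
    by (intro compact_imp_bounded compact_continuous_image y compact_Icc)
  then obtain B where "\<forall>s\<in>{a..b}. norm (y s) \<le> B"
    by (auto simp: bounded_iff)
  then have B: "norm (y s) \<le> B" if "s \<in> {a..b}" for s using that by blast
  have B0: "0 \<le> B" "0 \<le> b" using order_trans[OF norm_ge_zero B[OF l]] l a by auto
  have upos: "0 < sqrt (2 * pi * (u n)\<^sup>2) ^ DIM('a)" for n
    using pos(1)[of n] by simp
  have mono: "1 / sqrt (2 * pi * (u n)\<^sup>2) ^ DIM('a) \<le> 1 / sqrt (2 * pi * a\<^sup>2) ^ DIM('a)" for n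
    using u a
    by (intro divide_left_mono power_mono real_sqrt_le_mono mult_left_mono mult_pos_pos upos) auto
  have glim: "(\<lambda>n. gauss_density w (u n) (y (u n))) \<longlonglongrightarrow> gauss_density w l (y l)" for w
    unfolding gauss_density_def using pos
    by (intro tendsto_intros ylim lim) auto
  have 1: "(\<lambda>n. diffusion_density p (u n) (y (u n))) \<longlonglongrightarrow> diffusion_density p l (y l)"
    unfolding diffusion_density_integral
  proof (rule integral_dominated_convergence[where w = "\<lambda>_. 1 / sqrt (2 * pi * a\<^sup>2) ^ DIM('a)"])
    show "AE w in p. norm (gauss_density w (u n) (y (u n))) \<le> 1 / sqrt (2 * pi * a\<^sup>2) ^ DIM('a)" for n
      using order_trans[OF gauss_density_le mono[of n]] by (simp add: gauss_density_nonneg)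
  qed (use glim in auto)
  have 2: "(\<lambda>n. \<integral>w. gauss_density w (u n) (y (u n)) *\<^sub>R w \<partial>p)
      \<longlonglongrightarrow> (\<integral>w. gauss_density w l (y l) *\<^sub>R w \<partial>p)"
  \<comment> \<open>The majorant combines \<open>norm (y (u n))\<close> \<le> \<open>B\<close>,
    \<open>u n\<close> \<le> \<open>b\<close>, and the normalising constant at the smallest time
    \<open>a\<close>.\<close>
  proof (rule integral_dominated_convergence
      [where w = "\<lambda>_. (B + b) / sqrt (2 * pi * a\<^sup>2) ^ DIM('a)"])
    have "norm (gauss_density w (u n) (y (u n)) *\<^sub>R w) \<le> (B + b) / sqrt (2 * pi * a\<^sup>2) ^ DIM('a)"
      for n w
    proof -
      have "norm (gauss_density w (u n) (y (u n)) *\<^sub>R w)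
          \<le> (norm (y (u n)) + u n) * (1 / sqrt (2 * pi * (u n)\<^sup>2) ^ DIM('a))"
        using norm_scaleR_gauss_density_le[OF pos(1)[of n], of w "y (u n)"] by simp
      also have "\<dots> \<le> (B + b) * (1 / sqrt (2 * pi * a\<^sup>2) ^ DIM('a))"
        using u B[of "u n"] pos(1)[of n] B0 by (intro mult_mono mono add_mono) auto
      finally show ?thesis by simp
    qed
    then show "AE w in p. norm (gauss_density w (u n) (y (u n)) *\<^sub>R w)
        \<le> (B + b) / sqrt (2 * pi * a\<^sup>2) ^ DIM('a)" for n
      by simp
    show "AE w in p. (\<lambda>n. gauss_density w (u n) (y (u n)) *\<^sub>R w) \<longlonglongrightarrow> gauss_density w l (y l) *\<^sub>R w"
      using glim by (intro AE_I2 tendsto_intros)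
  qed auto
  have "diffusion_density p l (y l) \<noteq> 0" using diffusion_density_pos[OF pos(2), of "y l"] by simp
  then show "(\<lambda>n. diffusion_mean p (u n) (y (u n))) \<longlonglongrightarrow> diffusion_mean p l (y l)"
    unfolding diffusion_mean_integral[OF pos(1)] diffusion_mean_integral[OF pos(2)]
    by (intro tendsto_intros 1 2)
qed

end

section \<open>Trajectories and their integrals\<close>

text \<open>The selected solution is extensional, so \<open>x\<close> is compared through its
  restriction to \<open>I\<close>. Openness of \<open>I\<close> ensures that restricting does not
  change derivatives there.\<close>

lemma the_ode_solution_eq:
  assumes wp: "well_posed_at F I t (x t)" and x: "solves_ode_on F I x"
    and I: "open I" "t \<in> I" and u: "u \<in> I"
  shows "the_ode_solution F I t (x t) u = x u"
proof -
  have "ode_solution_through F I t (x t) (restrict x I)"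
    unfolding ode_solution_through_def solves_ode_on_def
  proof (intro conjI ballI)
    fix v assume v: "v \<in> I"
    have "(x has_vector_derivative F v (x v)) (at v)"
      using x v by (simp add: solves_ode_on_def)
    then have "(restrict x I has_vector_derivative F v (x v)) (at v)"
      by (rule has_vector_derivative_transform_within_open[OF _ I(1) v]) simp
    then show "(restrict x I has_vector_derivative F v (restrict x I v)) (at v)"
      using v by simp
  qed (use I in auto)
  then have "the_ode_solution F I t (x t) = restrict x I"
    using wp unfolding the_ode_solution_def well_posed_at_def by (blast intro: the1_equality)
  then show ?thesis using u by simp
qed

text \<open>The fundamental theorem of calculus with the integral running backward from
  \<open>t\<close> to \<open>s\<close>. The integrand \<open>f\<close> is kept apart from
  \<open>F\<close> because \<open>G_CTM\<close> and \<open>G_GCTM\<close> write it with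
  \<open>the_ode_solution\<close> and a posterior mean; agreement on the interval is enough.\<close>

lemma ode_integral_eq:
  fixes x :: "real \<Rightarrow> 'a::euclidean_space"
  assumes x: "solves_ode_on F I x" and I: "{s..t} \<subseteq> I" and st: "s \<le> t"
    and cont: "continuous_on {s..t} (\<lambda>u. F u (x u))"
    and f: "\<And>u. u \<in> {s..t} \<Longrightarrow> f u = F u (x u)"
  shows "x t + (LBINT u=ereal t..ereal s. f u) = x s"
proof -
  have "(LBINT u=ereal t..ereal s. f u) = x s - x t"
  proof (rule interval_integral_FTC_finite)
    show "continuous_on {min t s..max t s} f"
      using st cont f by (simp add: min_def max_def cong: continuous_on_cong_simp)
    show "(x has_vector_derivative f u) (at u within {min t s..max t s})"
      if "min t s \<le> u" "u \<le> max t s" for u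
    proof -
      have u: "u \<in> {s..t}" using that st by auto
      then have "(x has_vector_derivative F u (x u)) (at u)"
        using x I unfolding solves_ode_on_def by blast
      then show ?thesis using f[OF u] by (simp add: has_vector_derivative_at_within)
    qed
  qed
  then show ?thesis by simp
qed

text \<open>Inverts the time change and supplies the equations that turn \<open>xbar r\<close> into
  \<open>(1 - r) *\<^sub>R x (r / (1 - r))\<close>.\<close>

lemma rescaled_time_inverse:
  fixes r :: real
  assumes r: "0 < r" "r < 1"
  obtains t where "0 < t" "t = r / (1 - r)" "r = t / (1 + t)" "1 - r = 1 / (1 + t)"
proof -
  have e: "1 + r / (1 - r) = 1 / (1 - r)" using r by (simp add: field_simps)
  have 1: "0 < r / (1 - r)" using r by simp
  have 2: "r = r / (1 - r) / (1 + r / (1 - r))" unfolding e using r by simp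
  have 3: "1 - r = 1 / (1 + r / (1 - r))" unfolding e by simp
  show ?thesis by (rule that[OF 1 refl 2 3])
qed

section \<open>Transfer between the two flows\<close>

theorem theorem2:
  fixes p :: "'a::euclidean_space measure"
    and x xbar :: "real \<Rightarrow> 'a"
  assumes prob: "prob_space p"
    and sets_p: "sets p = sets borel"
    and x_ode: "solves_ode_on (probability_flow_field p) {0<..} x"
    and xbar: "\<And>t. 0 < t \<Longrightarrow> xbar (t / (1 + t)) = (1 / (1 + t)) *\<^sub>R x t"
    and wp_diffusion: "\<And>t. 0 < t \<Longrightarrow> well_posed_at (probability_flow_field p) {0<..} t (x t)"
    and wp_flow: "\<And>r. 0 < r \<Longrightarrow> r < 1 \<Longrightarrow> well_posed_at (flow_matching_field p) {0<..<1} r (xbar r)"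
  shows "(\<forall>t>0. \<forall>z. GDERIV (\<lambda>y. ln (diffusion_density p t y)) z :> score p t z
            \<and> - (t *\<^sub>R score p t z) = (1 / t) *\<^sub>R (z - diffusion_mean p t z))
    \<and> (\<forall>t>0. diffusion_mean p t (x t) = flow_mean p (t / (1 + t)) (xbar (t / (1 + t))))
    \<and> solves_ode_on (\<lambda>r z. (1 / r) *\<^sub>R (z - flow_mean p r z)) {0<..<1} xbar
    \<and> (\<forall>t s. 0 < s \<and> s \<le> t \<longrightarrow>
          G_CTM p (x t) t s
            = (1 + s) *\<^sub>R G_GCTM p (xbar (t / (1 + t))) (t / (1 + t)) (s / (1 + s)))
    \<and> (\<forall>t>0. g_CTM p (x t) t t
            = g_GCTM p (xbar (t / (1 + t))) (t / (1 + t)) (t / (1 + t)))"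
proof -
  have mean: "flow_mean p (t / (1 + t)) (xbar (t / (1 + t))) = diffusion_mean p t (x t)"
    if "0 < t" for t
    unfolding xbar[OF that] using flow_mean_rescale[OF that] .
  have dx: "(x has_vector_derivative (1 / t) *\<^sub>R (x t - diffusion_mean p t (x t))) (at t)"
    if "0 < t" for t
    using x_ode that unfolding solves_ode_on_def
    by (subst probability_flow_field_eq[OF prob sets_p that, symmetric]) simp
  have contx: "continuous_on S x" if "S \<subseteq> {0<..}" for S
    using that dx by (intro continuous_at_imp_continuous_on)
      (auto intro: has_vector_derivative_continuous)
  have contm: "continuous_on {a..b} (\<lambda>u. diffusion_mean p u (x u))" if "0 < a" for a b
    using that by (intro continuous_on_diffusion_mean prob sets_p contx) auto

  \<comment> \<open>On the unit interval \<open>xbar r\<close> equals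
    \<open>(1 - r) *\<^sub>R x (r / (1 - r))\<close>, which is differentiated by the chain and
    product rules.\<close>
  have xbar_ode: "solves_ode_on (flow_matching_field p) {0<..<1} xbar"
    unfolding solves_ode_on_def flow_matching_field_def
  proof
    fix r :: real assume r: "r \<in> {0<..<1}"
    then have r': "0 < r" "r < 1" by auto
    then obtain t where t: "0 < t" "t = r / (1 - r)" "r = t / (1 + t)" "1 - r = 1 / (1 + t)"
      by (rule rescaled_time_inverse)
    let ?m = "diffusion_mean p t (x t)"
    have D: "((\<lambda>r. r / (1 - r)) has_real_derivative 1 / (1 - r)\<^sup>2) (at r)"
      using r' by (auto intro!: derivative_eq_intros simp: power2_eq_square)
    have "(x has_vector_derivative (1 / t) *\<^sub>R (x t - ?m)) (at (r / (1 - r)))"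
      using dx[OF t(1)] by (simp only: t(2)[symmetric])
    from vector_diff_chain_at[OF D[unfolded has_real_derivative_iff_has_vector_derivative] this]
    have "((\<lambda>r. x (r / (1 - r))) has_vector_derivative
        (1 / (1 - r)\<^sup>2) *\<^sub>R ((1 / t) *\<^sub>R (x t - ?m))) (at r)"
      by (simp only: o_def)
    then have "((\<lambda>r. (1 - r) *\<^sub>R x (r / (1 - r))) has_vector_derivative
        (1 - r) *\<^sub>R ((1 / (1 - r)\<^sup>2) *\<^sub>R ((1 / t) *\<^sub>R (x t - ?m))) + (-1) *\<^sub>R x t) (at r)"
      unfolding t(2)
      by (intro has_vector_derivative_scaleR) (auto intro!: derivative_eq_intros)
    \<comment> \<open>With \<open>t = r / (1 - r)\<close> the first coefficient is
      \<open>1 / r\<close>; subtracting \<open>x t\<close> turns \<open>x t\<close> into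
      \<open>(1 - r) *\<^sub>R x t = xbar r\<close> inside the bracket.\<close>
    also have "(1 - r) *\<^sub>R ((1 / (1 - r)\<^sup>2) *\<^sub>R ((1 / t) *\<^sub>R (x t - ?m))) + (-1) *\<^sub>R x t
        = (1 / r) *\<^sub>R (xbar r - ?m)"
    proof -
      have "(1 - r) * ((1 / (1 - r)\<^sup>2) * (1 / t)) = 1 / r"
        unfolding t(2) using r' by (simp add: power2_eq_square)
      moreover have "xbar r = (1 - r) *\<^sub>R x t"
        using xbar[OF t(1)] unfolding t(3)[symmetric] t(4)[symmetric] .
      moreover have "1 / r * (1 - r) = 1 / r - 1" using r' by (simp add: field_simps)
      ultimately show ?thesis
        using r' by (simp add: scaleR_right_diff_distrib scaleR_left_diff_distrib)
    qed
    finally have "((\<lambda>r. (1 - r) *\<^sub>R x (r / (1 - r))) has_vector_derivative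
        (1 / r) *\<^sub>R (xbar r - ?m)) (at r)" .
    then have "(xbar has_vector_derivative (1 / r) *\<^sub>R (xbar r - ?m)) (at r)"
    proof (rule has_vector_derivative_transform_within_open[OF _ _ r])
      fix q :: real assume "q \<in> {0<..<1}"
      then have "0 < q" "q < 1" by auto
      then obtain s where s: "0 < s" "s = q / (1 - q)" "q = s / (1 + s)" "1 - q = 1 / (1 + s)"
        by (rule rescaled_time_inverse)
      show "(1 - q) *\<^sub>R x (q / (1 - q)) = xbar q"
        using xbar[OF s(1)] unfolding s(2)[symmetric] s(3)[symmetric] s(4)[symmetric] by simp
    qed simp
    moreover have "?m = flow_mean p r (xbar r)"
      using mean[OF t(1)] unfolding t(3)[symmetric] by simp
    ultimately show "(xbar has_vector_derivative (1 / r) *\<^sub>R (xbar r - flow_mean p r (xbar r))) (at r)"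
      by simp
  qed

  \<comment> \<open>The field is defined by the score and the integrand by the posterior mean;
    Tweedie's formula identifies them along the trajectory.\<close>
  have G1: "G_CTM p (x t) t s = x s" if st: "0 < s" "s \<le> t" for t s
    unfolding G_CTM_def Let_def
  proof (rule ode_integral_eq[OF x_ode _ st(2)])
    show "{s..t} \<subseteq> {0<..}" using st by auto
    have "continuous_on {s..t} (\<lambda>u. (1 / u) *\<^sub>R (x u - diffusion_mean p u (x u)))"
      using st by (intro continuous_intros contx contm) auto
    then show "continuous_on {s..t} (\<lambda>u. probability_flow_field p u (x u))"
      using st by (subst continuous_on_cong[OF refl probability_flow_field_eq[OF prob sets_p]]) auto
    fix u assume "u \<in> {s..t}"
    then have u: "0 < u" using st by auto
    have "the_ode_solution (probability_flow_field p) {0<..} t (x t) u = x u"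
      using wp_diffusion st u by (intro the_ode_solution_eq x_ode) auto
    then show "(1 / u) *\<^sub>R (the_ode_solution (probability_flow_field p) {0<..} t (x t) u -
        diffusion_mean p u (the_ode_solution (probability_flow_field p) {0<..} t (x t) u))
      = probability_flow_field p u (x u)"
      by (simp add: probability_flow_field_eq[OF prob sets_p u])
  qed

  have G2: "G_GCTM p (xbar t) t s = xbar s" if st: "0 < s" "s \<le> t" "t < 1" for t s
    unfolding G_GCTM_def Let_def
  proof (rule ode_integral_eq[OF xbar_ode _ st(2)])
    show sub: "{s..t} \<subseteq> {0<..<1}" using st by auto
    have cx: "continuous_on {s..t} xbar"
      using xbar_ode sub unfolding solves_ode_on_def
      by (intro continuous_at_imp_continuous_on) (blast intro: has_vector_derivative_continuous)
    \<comment> \<open>Continuity of the flow mean is pulled back to the diffusion side through the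
      increasing time change, which maps \<open>{s..t}\<close> into a compact interval of positive
      times.\<close>
    have "continuous_on {s..t} (\<lambda>r. diffusion_mean p (r / (1 - r)) (x (r / (1 - r))))"
    proof (rule continuous_on_compose2[OF contm])
      show "continuous_on {s..t} (\<lambda>r. r / (1 - r))"
        using st by (intro continuous_intros) auto
      show "(\<lambda>r. r / (1 - r)) ` {s..t} \<subseteq> {s / (1 - s)..t / (1 - t)}"
        using st by (auto intro!: frac_le)
      show "0 < s / (1 - s)" using st by auto
    qed
    moreover have "flow_mean p r (xbar r) = diffusion_mean p (r / (1 - r)) (x (r / (1 - r)))"
      if "r \<in> {s..t}" for r
    proof -
      have "0 < r" "r < 1" using st that by auto
      then obtain v where v: "0 < v" "v = r / (1 - r)" "r = v / (1 + v)" "1 - r = 1 / (1 + v)"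
        by (rule rescaled_time_inverse)
      show ?thesis
        using mean[OF v(1)] unfolding v(2)[symmetric] v(3)[symmetric] .
    qed
    ultimately have "continuous_on {s..t} (\<lambda>r. flow_mean p r (xbar r))"
      by (simp cong: continuous_on_cong_simp)
    then show "continuous_on {s..t} (\<lambda>u. flow_matching_field p u (xbar u))"
      unfolding flow_matching_field_def using st by (intro continuous_intros cx) auto
    fix u assume "u \<in> {s..t}"
    then have u: "u \<in> {0<..<1}" using sub by blast
    have "the_ode_solution (flow_matching_field p) {0<..<1} t (xbar t) u = xbar u"
      using wp_flow st u by (intro the_ode_solution_eq xbar_ode) auto
    then show "(1 / u) *\<^sub>R (the_ode_solution (flow_matching_field p) {0<..<1} t (xbar t) u -
        flow_mean p u (the_ode_solution (flow_matching_field p) {0<..<1} t (xbar t) u))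
      = flow_matching_field p u (xbar u)"
      by (simp add: flow_matching_field_def)
  qed

  show ?thesis
  proof (intro conjI allI impI)
    show "GDERIV (\<lambda>y. ln (diffusion_density p t y)) z :> score p t z" if "0 < t" for t z
      unfolding score_eq[OF prob sets_p that]
      by (rule gderiv_ln_diffusion_density[OF prob sets_p that])
    show "- (t *\<^sub>R score p t z) = (1 / t) *\<^sub>R (z - diffusion_mean p t z)" if "0 < t" for t z
      using probability_flow_field_eq[OF prob sets_p that] by (simp add: probability_flow_field_def)
    show "diffusion_mean p t (x t) = flow_mean p (t / (1 + t)) (xbar (t / (1 + t)))" if "0 < t" for t
      using mean[OF that] by simp
    show "solves_ode_on (\<lambda>r z. (1 / r) *\<^sub>R (z - flow_mean p r z)) {0<..<1} xbar"
      using xbar_ode by (simp add: solves_ode_on_def flow_matching_field_def)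
    \<comment> \<open>Both sides are trajectory values: \<open>x s\<close> on the left, and
      \<open>xbar (s / (1 + s))\<close>, scaled by \<open>1 + s\<close>, on the right.\<close>
    show "G_CTM p (x t) t s = (1 + s) *\<^sub>R G_GCTM p (xbar (t / (1 + t))) (t / (1 + t)) (s / (1 + s))"
      if "0 < s \<and> s \<le> t" for t s
    proof -
      have "s / (1 + s) \<le> t / (1 + t)" using that by (simp add: field_simps)
      then show ?thesis
        using that xbar[of s] by (subst G2) (auto simp: G1)
    qed
    \<comment> \<open>At equal times both definitions take their second branch, so this is the
      equality of posterior means.\<close>
    show "g_CTM p (x t) t t = g_GCTM p (xbar (t / (1 + t))) (t / (1 + t)) (t / (1 + t))"
      if "0 < t" for t
      using mean[OF that] by (simp add: g_CTM_def g_GCTM_def)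
  qed
qed

end
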